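(* Let $\Phi$ be the root system of type $G_2$ with simple roots $a$ (short) and $b$ (long), and let $N_{r,s}$ ($r,s\in\Phi$, $r+s\neq 0$) be the structure constants of the complex simple Lie algebra of type $G_2$ with respect to a Chevalley basis. Suppose that the structure constants corresponding to the extraspecial pairs, namely $N_{a,b}$, $N_{a,a+b}$, $N_{a,2a+b}$, $N_{b,3a+b}$, are all positive. Then the structure constants have the following values (all $N_{r,s}$ with $r+s\neq 0$ not listed are zero): Row $r=-3a-2b$: $N_{r,b}=1,\ N_{r,a+b}=-1,\ N_{r,2a+b}=1,\ N_{r,3a+b}=-1$. Row $r=-3a-b$: $N_{r,-b}=1,\ N_{r,a}=1,\ N_{r,2a+b}=-1,\ N_{r,3a+2b}=-1$. Row $r=-2a-b$: $N_{r,-a-b}=-3,\ N_{r,-a}=3,\ N_{r,a}=2,\ N_{r,a+b}=-2,\ N_{r,3a+b}=-1,\ N_{r,3a+2b}=1$. Row $r=-a-b$: $N_{r,-2a-b}=3,\ N_{r,-a}=2,\ N_{r,a}=3,\ N_{r,b}=-1,\ N_{r,2a+b}=-2,\ N_{r,3a+2b}=-1$. Row $r=-b$: $N_{r,-3a-b}=-1,\ N_{r,-a}=1,\ N_{r,a+b}=-1,\ N_{r,3a+2b}=1$. Row $r=-a$: $N_{r,-2a-b}=-3,\ N_{r,-a-b}=-2,\ N_{r,-b}=-1,\ N_{r,a+b}=3,\ N_{r,2a+b}=2,\ N_{r,3a+b}=1$. Row $r=a$: $N_{r,-3a-b}=-1,\ N_{r,-2a-b}=-2,\ N_{r,-a-b}=-3,\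 N_{r,b}=1,\ N_{r,a+b}=2,\ N_{r,2a+b}=3$. Row $r=b$: $N_{r,-3a-2b}=-1,\ N_{r,-a-b}=1,\ N_{r,a}=-1,\ N_{r,3a+b}=1$. Row $r=a+b$: $N_{r,-3a-2b}=1,\ N_{r,-2a-b}=2,\ N_{r,-a}=-3,\ N_{r,-b}=1,\ N_{r,a}=-2,\ N_{r,2a+b}=-3$. Row $r=2a+b$: $N_{r,-3a-2b}=-1,\ N_{r,-3a-b}=1,\ N_{r,-a-b}=2,\ N_{r,-a}=-2,\ N_{r,a}=-3,\ N_{r,a+b}=3$. Row $r=3a+b$: $N_{r,-3a-2b}=1,\ N_{r,-2a-b}=1,\ N_{r,-a}=-1,\ N_{r,b}=-1$. Row $r=3a+2b$: $N_{r,-3a-b}=1,\ N_{r,-2a-b}=-1,\ N_{r,-a-b}=1,\ N_{r,-b}=-1$.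
   Context: Root system: in Euclidean $\mathbb{R}^3$ with orthonormal basis $\varepsilon_1,\varepsilon_2,\varepsilon_3$ put $a=\varepsilon_1-\varepsilon_2$, $b=-2\varepsilon_1+\varepsilon_2+\varepsilon_3$, so $(a,a)=2$, $(b,b)=6$, $(a,b)=-3$. The root system $\Phi$ of type $G_2$ is $\{\pm a,\pm b,\pm(a+b),\pm(2a+b),\pm(3a+b),\pm(3a+2b)\}$, with fundamental roots $a,b$. Structure constants: the complex simple Lie algebra of type $G_2$ has a Chevalley basis $\{h_a,h_b\}\cup\{e_r: r\in\Phi\}$, where $[h_r,h_s]=0$, $[h_r,e_s]=\frac{2(r,s)}{(r,r)}e_s$, $[e_r,e_{-r}]=h_r$ (with $h_r$ the coroot element of $r$, an integer combination of $h_a,h_b$), $[e_r,e_s]=N_{r,s}e_{r+s}$ if $r,s,r+s\in\Phi$, and $[e_r,e_s]=0$ if $r+s\notin\Phi\cup\{0\}$, in which case $N_{r,s}:=0$. For a Chevalley basis $N_{-r,-s}=-N_{r,s}$ and $N_{r,s}=\pm(p+1)$ when $r,s,r+s\in\Phi$, where $p$ is the largest integer with $s-pr\in\Phi$. The pairs $(a,b),(a,a+b),(a,2a+b),(b,3a+b)$ are the extraspecial pairs of roots for the ordering $a\prec b\prec a+b\prec 2a+b\prec 3a+b\prec 3a+2b$. *)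

theory Defs
  imports "HOL-Analysis.Analysis"
begin

locale lie_algebra = vector_space scale
  for scale :: "'k::field \<Rightarrow> 'g::ab_group_add \<Rightarrow> 'g" +
  fixes bracket :: "'g \<Rightarrow> 'g \<Rightarrow> 'g"
  assumes bracket_add_left: "bracket (x + y) z = bracket x z + bracket y z"
    and bracket_add_right: "bracket x (y + z) = bracket x y + bracket x z"
    and bracket_scale_left: "bracket (scale c x) y = scale c (bracket x y)"
    and bracket_scale_right: "bracket x (scale c y) = scale c (bracket x y)"
    and bracket_self: "bracket x x = 0"
    and jacobi: "bracket x (bracket y z) + bracket y (bracket z x) + bracket z (bracket x y) = 0"
begin

definition ideal :: "'g set \<Rightarrow> bool" where
  "ideal I \<longleftrightarrow> subspace I \<and> (\<forall>x. \<forall>y\<in>I. bracket x y \<in> I)"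

end

locale simple_lie_algebra = lie_algebra scale bracket
  for scale :: "'k::field \<Rightarrow> 'g::ab_group_add \<Rightarrow> 'g" and bracket +
  assumes not_abelian: "\<exists>x y. bracket x y \<noteq> 0"
    and ideals_trivial: "ideal I \<Longrightarrow> I = {0} \<or> I = UNIV"

definition ra :: "real^3" where
  "ra = axis 1 1 - axis 2 1"

definition rb :: "real^3" where
  "rb = -2 *\<^sub>R axis 1 1 + axis 2 1 + axis 3 1"

definition G2_roots :: "(real^3) set" where
  "G2_roots =
    {ra, rb, ra + rb, 2 *\<^sub>R ra + rb, 3 *\<^sub>R ra + rb, 3 *\<^sub>R ra + 2 *\<^sub>R rb} \<union>
    {-ra, -rb, -(ra + rb), -(2 *\<^sub>R ra + rb), -(3 *\<^sub>R ra + rb), -(3 *\<^sub>R ra + 2 *\<^sub>R rb)}"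

definition cartan_number :: "real^3 \<Rightarrow> real^3 \<Rightarrow> real" where
  "cartan_number r s = 2 * (r \<bullet> s) / (r \<bullet> r)"

definition coroot :: "real^3 \<Rightarrow> real^3" where
  "coroot r = (2 / (r \<bullet> r)) *\<^sub>R r"

definition string_depth :: "real^3 \<Rightarrow> real^3 \<Rightarrow> int" where
  "string_depth r s = (GREATEST p. s - of_int p *\<^sub>R r \<in> G2_roots)"

text \<open>
  The relations below exhibit the root space decomposition with respect to the span of
  \<open>h ra\<close> and \<open>h rb\<close>, with root system \<open>G2_roots\<close>; this is what makes the algebra one of
  type \<open>G\<^sub>2\<close>. The elements \<open>h r\<close> and \<open>e r\<close> and the constants \<open>N r s\<close> are only meaningful
  for roots \<open>r\<close>, \<open>s\<close>, and \<open>N r s\<close> is left unconstrained when \<open>r + s = 0\<close>.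
  The last two assumptions are each implied by the other one together with the
  remaining assumptions; textbooks take either as part of the definition.
\<close>

locale G2_chevalley_basis = simple_lie_algebra scale bracket
  for scale :: "complex \<Rightarrow> 'g::ab_group_add \<Rightarrow> 'g" and bracket +
  fixes h :: "real^3 \<Rightarrow> 'g" and e :: "real^3 \<Rightarrow> 'g" and N :: "real^3 \<Rightarrow> real^3 \<Rightarrow> int"
  assumes basis_distinct: "inj_on e G2_roots" "h ra \<noteq> h rb" "{h ra, h rb} \<inter> e ` G2_roots = {}"
    and basis_independent: "independent ({h ra, h rb} \<union> e ` G2_roots)"
    and basis_spans: "span ({h ra, h rb} \<union> e ` G2_roots) = UNIV"
    and h_coroot: "r \<in> G2_roots \<Longrightarrow>
      \<exists>m n :: int. coroot r = of_int m *\<^sub>R coroot ra + of_int n *\<^sub>R coroot rb \<and>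
        h r = scale (of_int m) (h ra) + scale (of_int n) (h rb)"
    and bracket_h_h: "r \<in> G2_roots \<Longrightarrow> s \<in> G2_roots \<Longrightarrow> bracket (h r) (h s) = 0"
    and bracket_h_e: "r \<in> G2_roots \<Longrightarrow> s \<in> G2_roots \<Longrightarrow>
      bracket (h r) (e s) = scale (of_real (cartan_number r s)) (e s)"
    and bracket_e_opposite: "r \<in> G2_roots \<Longrightarrow> bracket (e r) (e (- r)) = h r"
    and bracket_e_e: "r \<in> G2_roots \<Longrightarrow> s \<in> G2_roots \<Longrightarrow> r + s \<in> G2_roots \<Longrightarrow>
      bracket (e r) (e s) = scale (of_int (N r s)) (e (r + s))"
    and bracket_e_e_zero: "r \<in> G2_roots \<Longrightarrow> s \<in> G2_roots \<Longrightarrow> r + s \<notin> G2_roots \<union> {0} \<Longrightarrow>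
      bracket (e r) (e s) = 0"
    and N_zero: "r \<in> G2_roots \<Longrightarrow> s \<in> G2_roots \<Longrightarrow> r + s \<notin> G2_roots \<union> {0} \<Longrightarrow> N r s = 0"
    and N_uminus: "r \<in> G2_roots \<Longrightarrow> s \<in> G2_roots \<Longrightarrow> r + s \<in> G2_roots \<Longrightarrow>
      N (- r) (- s) = - N r s"
    and N_string: "r \<in> G2_roots \<Longrightarrow> s \<in> G2_roots \<Longrightarrow> r + s \<in> G2_roots \<Longrightarrow>
      N r s = string_depth r s + 1 \<or> N r s = - (string_depth r s + 1)"

text \<open>Each row is a root \<open>r\<close> together with the list of pairs \<open>(s, N r s)\<close>.\<close>

definition G2_table :: "((real^3) \<times> ((real^3) \<times> int) list) list" where
  "G2_table =
   (let a = ra; b = rb in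
    [(-3 *\<^sub>R a - 2 *\<^sub>R b,
        [(b, 1), (a + b, -1), (2 *\<^sub>R a + b, 1), (3 *\<^sub>R a + b, -1)]),
     (-3 *\<^sub>R a - b,
        [(- b, 1), (a, 1), (2 *\<^sub>R a + b, -1), (3 *\<^sub>R a + 2 *\<^sub>R b, -1)]),
     (-2 *\<^sub>R a - b,
        [(- a - b, -3), (- a, 3), (a, 2), (a + b, -2), (3 *\<^sub>R a + b, -1),
         (3 *\<^sub>R a + 2 *\<^sub>R b, 1)]),
     (- a - b,
        [(-2 *\<^sub>R a - b, 3), (- a, 2), (a, 3), (b, -1), (2 *\<^sub>R a + b, -2),
         (3 *\<^sub>R a + 2 *\<^sub>R b, -1)]),
     (- b,
        [(-3 *\<^sub>R a - b, -1), (- a, 1), (a + b, -1), (3 *\<^sub>R a + 2 *\<^sub>R b, 1)]),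
     (- a,
        [(-2 *\<^sub>R a - b, -3), (- a - b, -2), (- b, -1), (a + b, 3), (2 *\<^sub>R a + b, 2),
         (3 *\<^sub>R a + b, 1)]),
     (a,
        [(-3 *\<^sub>R a - b, -1), (-2 *\<^sub>R a - b, -2), (- a - b, -3), (b, 1), (a + b, 2),
         (2 *\<^sub>R a + b, 3)]),
     (b,
        [(-3 *\<^sub>R a - 2 *\<^sub>R b, -1), (- a - b, 1), (a, -1), (3 *\<^sub>R a + b, 1)]),
     (a + b,
        [(-3 *\<^sub>R a - 2 *\<^sub>R b, 1), (-2 *\<^sub>R a - b, 2), (- a, -3), (- b, 1), (a, -2),
         (2 *\<^sub>R a + b, -3)]),
     (2 *\<^sub>R a + b,
        [(-3 *\<^sub>R a - 2 *\<^sub>R b, -1), (-3 *\<^sub>R a - b, 1), (- a - b, 2), (- a, -2), (a, -3),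
         (a + b, 3)]),
     (3 *\<^sub>R a + b,
        [(-3 *\<^sub>R a - 2 *\<^sub>R b, 1), (-2 *\<^sub>R a - b, 1), (- a, -1), (b, -1)]),
     (3 *\<^sub>R a + 2 *\<^sub>R b,
        [(-3 *\<^sub>R a - b, 1), (-2 *\<^sub>R a - b, -1), (- a - b, 1), (- b, -1)])])"

definition G2_entries :: "((real^3) \<times> (real^3) \<times> int) set" where
  "G2_entries = {(r, s, n). \<exists>row. (r, row) \<in> set G2_table \<and> (s, n) \<in> set row}"

end

theory Submission
  imports Defs
begin

text \<open>
  Every pair of roots whose sum is a root belongs to a triple \<open>r + s + t = 0\<close>. The Jacobi identity
  on \<open>e r, e s, e t\<close> shows that \<open>N r s / (t, t)\<close> is invariant under cyclic rotation of the triple;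
  with \<open>N s r = - N r s\<close> and \<open>N (- r) (- s) = - N r s\<close> all twelve constants attached to the triple
  and its negative follow from a single one. Up to these symmetries there are five triples. The
  extraspecial pairs settle four of them, their absolute values being known from root strings, and
  the Jacobi identity on \<open>e a, e b, e (2a + b)\<close> settles the fifth, that of the pair
  \<open>(a + b, 2a + b)\<close>.
\<close>

section \<open>Integer coordinates on the root lattice\<close>

text \<open>Coordinates in the basis of fundamental roots turn sums, equality and root membership of
  vectors into integer arithmetic.\<close>

definition lat :: "int \<Rightarrow> int \<Rightarrow> real^3" where
  "lat i j = of_int i *\<^sub>R ra + of_int j *\<^sub>R rb"

text \<open>The Euclidean inner product in these coordinates; 2, -3 and 6 are the entries of the
  Gram matrix of \<open>ra\<close> and \<open>rb\<close>.\<close>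

definition lat_form :: "int \<Rightarrow> int \<Rightarrow> int \<Rightarrow> int \<Rightarrow> int" where
  "lat_form i j k l = 2 * i * k - 3 * (i * l + j * k) + 6 * j * l"

definition root_coords :: "(int \<times> int) set" where
  "root_coords = {(1,0), (0,1), (1,1), (2,1), (3,1), (3,2),
     (-1,0), (0,-1), (-1,-1), (-2,-1), (-3,-1), (-3,-2)}"

lemma ra_lat: "ra = lat 1 0" and rb_lat: "rb = lat 0 1"
  by (simp_all add: lat_def)

lemma lat_add: "lat i j + lat k l = lat (i + k) (j + l)"
  and lat_diff: "lat i j - lat k l = lat (i - k) (j - l)"
  and lat_uminus: "- lat i j = lat (- i) (- j)"
  and lat_scaleR_of_int: "of_int m *\<^sub>R lat i j = lat (m * i) (m * j)"
  and lat_scaleR_numeral: "numeral w *\<^sub>R lat i j = lat (numeral w * i) (numeral w * j)"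
  and lat_scaleR_neg_numeral: "(- numeral w) *\<^sub>R lat i j = lat (- numeral w * i) (- numeral w * j)"
  by (simp_all add: lat_def algebra_simps)

lemmas lat_simps = lat_add lat_diff lat_uminus lat_scaleR_numeral lat_scaleR_neg_numeral

lemma lat_eq_iff [simp]: "lat i j = lat k l \<longleftrightarrow> i = k \<and> j = l"
proof
  assume eq: "lat i j = lat k l"
  \<comment> \<open>The third coordinate comes from \<open>rb\<close> alone, and the second then
    determines the multiple of \<open>ra\<close>.\<close>
  have "lat i j $ 3 = of_int j" "lat k l $ 3 = of_int l"
    "lat i j $ 2 = of_int (j - i)" "lat k l $ 2 = of_int (l - k)"
    by (simp_all add: lat_def ra_def rb_def axis_def)
  with eq have "j = l" "j - i = l - k"
    by (metis of_int_eq_iff)+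
  then show "i = k \<and> j = l" by simp
qed simp

lemma lat_eq_0_iff [simp]: "lat i j = 0 \<longleftrightarrow> i = 0 \<and> j = 0"
proof -
  have "lat 0 0 = 0" by (simp add: lat_def)
  then show ?thesis by (metis lat_eq_iff)
qed

lemma lat_inner: "lat i j \<bullet> lat k l = of_int (lat_form i j k l)"
proof -
  have "ra \<bullet> ra = 2" "ra \<bullet> rb = -3" "rb \<bullet> ra = -3" "rb \<bullet> rb = 6"
    by (simp_all add: ra_def rb_def inner_axis_axis inner_diff inner_add_left inner_add_right)
  then show ?thesis
    by (simp add: lat_def lat_form_def algebra_simps)
qed

lemma G2_roots_eq_lat_image: "G2_roots = (\<lambda>(i, j). lat i j) ` root_coords"
  by (simp add: G2_roots_def root_coords_def ra_lat rb_lat lat_simps insert_commute)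

lemma lat_in_G2_roots: "lat i j \<in> G2_roots \<longleftrightarrow> (i, j) \<in> root_coords"
  by (force simp: G2_roots_eq_lat_image)

lemma zero_notin_G2_roots: "0 \<notin> G2_roots"
  by (auto simp: G2_roots_eq_lat_image root_coords_def)

lemma string_depth_lat_eqI:
  assumes "(k - p * i, l - p * j) \<in> root_coords"
    and "\<And>q. (k - q * i, l - q * j) \<in> root_coords \<Longrightarrow> q \<le> p"
  shows "string_depth (lat i j) (lat k l) = p"
  unfolding string_depth_def using assms
  by (intro Greatest_equality) (simp_all add: lat_scaleR_of_int lat_diff lat_in_G2_roots)

text \<open>A finite check over all pairs of roots. Its contrapositive yields the zero part of the
  theorem: a pair outside the table does not sum to a root.\<close>

lemma G2_entries_complete:
  assumes "r \<in> G2_roots" "s \<in> G2_roots" "r + s \<in> G2_roots"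
  shows "\<exists>n. (r, s, n) \<in> G2_entries"
proof -
  have "\<forall>(i, j) \<in> root_coords. \<forall>(k, l) \<in> root_coords.
    (i + k, j + l) \<in> root_coords \<longrightarrow> (\<exists>n. (lat i j, lat k l, n) \<in> G2_entries)"
    unfolding root_coords_def G2_entries_def G2_table_def Let_def ra_lat rb_lat lat_simps
    by (simp add: lat_simps ex_disj_distrib conj_disj_distribR)
  moreover obtain i j where "r = lat i j" "(i, j) \<in> root_coords"
    using assms(1) by (auto simp: G2_roots_eq_lat_image)
  moreover obtain k l where "s = lat k l" "(k, l) \<in> root_coords"
    using assms(2) by (auto simp: G2_roots_eq_lat_image)
  ultimately show ?thesis
    using assms(3) by (fastforce simp: lat_add lat_in_G2_roots)
qed

section \<open>Relations between the structure constants\<close>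

text \<open>Cramer's rule, to be applied to the Gram matrix of two independent roots.\<close>

lemma symmetric_2x2_system_trivial:
  fixes x y :: real
  assumes "A * x + B * y = 0" "B * x + D * y = 0" "A * D \<noteq> B\<^sup>2"
  shows "x = 0" "y = 0"
proof -
  have "(A * D - B\<^sup>2) * x = D * (A * x + B * y) - B * (B * x + D * y)"
    "(A * D - B\<^sup>2) * y = A * (B * x + D * y) - B * (A * x + B * y)"
    by (simp_all add: algebra_simps power2_eq_square)
  with assms show "x = 0" "y = 0" by (simp_all only:) simp_all
qed

context lie_algebra
begin

lemma bracket_zero_left [simp]: "bracket 0 x = 0"
  using bracket_add_left[of 0 0 x] by simp

lemma bracket_zero_right [simp]: "bracket x 0 = 0"
  using bracket_add_right[of x 0 0] by simp

lemma bracket_anticommute: "bracket y x = - bracket x y"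
proof -
  have "0 = bracket (x + y) (x + y)"
    by (simp only: bracket_self)
  also have "\<dots> = bracket x y + bracket y x"
    by (simp only: bracket_add_left bracket_add_right) (simp add: bracket_self)
  finally have "bracket x y + bracket y x = 0" by simp
  then show ?thesis by (rule minus_unique[symmetric])
qed

end

section \<open>Consequences of the Jacobi identity for a Chevalley basis\<close>

context G2_chevalley_basis
begin

lemma e_nonzero: "r \<in> G2_roots \<Longrightarrow> e r \<noteq> 0"
  using basis_independent dependent_zero by force

lemma scale_e_eq_0_iff [simp]: "r \<in> G2_roots \<Longrightarrow> scale c (e r) = 0 \<longleftrightarrow> c = 0"
  using e_nonzero by simp

lemma N_anticommute:
  assumes "r \<in> G2_roots" "s \<in> G2_roots" "r + s \<in> G2_roots"
  shows "N s r = - N r s"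
proof -
  have "scale (of_int (N s r)) (e (r + s)) = - scale (of_int (N r s)) (e (r + s))"
    using bracket_anticommute[of "e s" "e r"] bracket_e_e[of r s] bracket_e_e[of s r] assms
    by (simp add: add.commute)
  then have "scale (of_int (N s r + N r s)) (e (r + s)) = 0"
    by (simp add: scale_left_distrib)
  then have "(of_int (N s r + N r s) :: complex) = 0"
    using assms scale_e_eq_0_iff by blast
  then show ?thesis
    by (simp only: of_int_eq_0_iff add_eq_0_iff2)
qed

text \<open>Since \<open>[e s, e t]\<close> is a multiple of \<open>e (- r)\<close>, and likewise
  cyclically, the Jacobi identity becomes a linear relation between \<open>h r\<close>,
  \<open>h s\<close>, \<open>h t\<close>. Letting it act on \<open>e u\<close> turns it into an
  equation between numbers.\<close>

lemma N_jacobi_opposite: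
  assumes roots: "r \<in> G2_roots" "s \<in> G2_roots" "t \<in> G2_roots" "u \<in> G2_roots"
    and sum: "r + s + t = 0"
    and neg: "- r \<in> G2_roots" "- s \<in> G2_roots" "- t \<in> G2_roots"
  shows "N s t * cartan_number r u + N t r * cartan_number s u + N r s * cartan_number t u = 0"
proof -
  have sums: "s + t = - r" "t + r = - s" "r + s = - t"
    using sum by (simp_all add: eq_neg_iff_add_eq_0 ac_simps)
  have "scale (of_int (N s t)) (h r) + scale (of_int (N t r)) (h s) + scale (of_int (N r s)) (h t) = 0"
    using jacobi[of "e r" "e s" "e t"] roots neg
    by (simp add: sums bracket_e_e bracket_scale_right bracket_e_opposite)
  then have "bracket (scale (of_int (N s t)) (h r) + scale (of_int (N t r)) (h s)
      + scale (of_int (N r s)) (h t)) (e u) = 0"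
    by simp
  then have "scale (of_real (N s t * cartan_number r u + N t r * cartan_number s u
      + N r s * cartan_number t u)) (e u) = 0"
    using roots by (simp add: bracket_add_left bracket_scale_left bracket_h_e scale_left_distrib)
  then show ?thesis
    using scale_e_eq_0_iff[OF \<open>u \<in> G2_roots\<close>] of_real_eq_0_iff by blast
qed

text \<open>As \<open>s + t\<close> is neither a root nor zero, one of the three Jacobi terms
  vanishes; the other two are multiples of \<open>e (r + s + t)\<close>. This links constants of
  different triples.\<close>

lemma N_jacobi:
  assumes "r \<in> G2_roots" "s \<in> G2_roots" "t \<in> G2_roots"
    and "r + s \<in> G2_roots" "t + r \<in> G2_roots" "s + t \<notin> G2_roots \<union> {0}"
    and "r + s + t \<in> G2_roots"
  shows "N t r * N s (t + r) + N r s * N t (r + s) = 0"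
proof -
  have eq: "s + (t + r) = r + s + t" "t + (r + s) = r + s + t" by simp_all
  have "scale (of_int (N t r * N s (t + r) + N r s * N t (r + s))) (e (r + s + t)) = 0"
    using jacobi[of "e r" "e s" "e t"] assms
    by (simp add: bracket_e_e bracket_e_e_zero bracket_scale_right scale_left_distrib eq)
  then have "(of_int (N t r * N s (t + r) + N r s * N t (r + s)) :: complex) = 0"
    using assms scale_e_eq_0_iff by blast
  then show ?thesis
    by (simp only: of_int_eq_0_iff)
qed

lemma N_cyclic:
  assumes roots: "r \<in> G2_roots" "s \<in> G2_roots" "t \<in> G2_roots"
    and sum: "r + s + t = 0"
    and neg: "- r \<in> G2_roots" "- s \<in> G2_roots" "- t \<in> G2_roots"
    and indep: "(r \<bullet> r) * (s \<bullet> s) \<noteq> (r \<bullet> s)\<^sup>2"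
  shows "N s t / (r \<bullet> r) = N r s / (t \<bullet> t)" "N t r / (s \<bullet> s) = N r s / (t \<bullet> t)"
proof -
  \<comment> \<open>\<open>x\<close> and \<open>y\<close> are the defects of the two claimed
    equalities. Eliminating \<open>t = - r - s\<close> from the Jacobi relation shows that
    \<open>x r + y s\<close> is orthogonal to every root \<open>u\<close>; taking
    \<open>u = r\<close> and \<open>u = s\<close> gives a system whose matrix is the Gram matrix,
    nonsingular by \<open>indep\<close>.\<close>
  define x where "x = N s t / (r \<bullet> r) - N r s / (t \<bullet> t)"
  define y where "y = N t r / (s \<bullet> s) - N r s / (t \<bullet> t)"
  have t: "t = - r - s"
    using sum by (metis add.commute add_eq_0_iff diff_conv_add_uminus minus_add)
  have *: "(r \<bullet> u) * x + (s \<bullet> u) * y = 0" if "u \<in> G2_roots" for u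
  proof -
    have "N s t * (2 * (r \<bullet> u) / (r \<bullet> r)) + N t r * (2 * (s \<bullet> u) / (s \<bullet> s))
        + N r s * (2 * (t \<bullet> u) / (t \<bullet> t)) = 0"
      using N_jacobi_opposite[OF roots that sum neg] by (simp add: cartan_number_def)
    moreover have "t \<bullet> u = - (r \<bullet> u) - (s \<bullet> u)"
      by (simp add: t inner_diff_left)
    ultimately have "2 * ((r \<bullet> u) * x + (s \<bullet> u) * y) = 0"
      by (simp add: x_def y_def algebra_simps diff_divide_distrib)
    then show ?thesis by simp
  qed
  have "x = 0" "y = 0"
    using symmetric_2x2_system_trivial[of "r \<bullet> r" x "r \<bullet> s" y "s \<bullet> s"] *[of r] *[of s] roots indep
    by (simp_all add: inner_commute)
  then show "N s t / (r \<bullet> r) = N r s / (t \<bullet> t)" "N t r / (s \<bullet> s) = N r s / (t \<bullet> t)"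
    by (simp_all add: x_def y_def)
qed

text \<open>The cyclic rule with denominators cleared, so that it lives in the integers. The third
  root is minus the sum of the other two, hence \<open>q\<close> is its squared length as
  well.\<close>

lemma N_lat_cyclic:
  assumes "(i, j) \<in> root_coords" "(k, l) \<in> root_coords" "(- i - k, - j - l) \<in> root_coords"
    and "(- i, - j) \<in> root_coords" "(- k, - l) \<in> root_coords" "(i + k, j + l) \<in> root_coords"
    and "lat_form i j i j * lat_form k l k l \<noteq> (lat_form i j k l)\<^sup>2"
  defines "q \<equiv> lat_form (i + k) (j + l) (i + k) (j + l)"
  shows "N (lat k l) (lat (- i - k) (- j - l)) * q = N (lat i j) (lat k l) * lat_form i j i j"
    and "N (lat (- i - k) (- j - l)) (lat i j) * q = N (lat i j) (lat k l) * lat_form k l k l"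
proof -
  let ?r = "lat i j" and ?s = "lat k l" and ?t = "lat (- i - k) (- j - l)"
  have roots: "?r \<in> G2_roots" "?s \<in> G2_roots" "?t \<in> G2_roots"
    "- ?r \<in> G2_roots" "- ?s \<in> G2_roots" "- ?t \<in> G2_roots"
    using assms by (simp_all add: lat_in_G2_roots lat_uminus add.commute)
  have sum: "?r + ?s + ?t = 0"
    by (simp add: lat_def algebra_simps)
  have "(lat_form i j i j :: real) * lat_form k l k l \<noteq> (lat_form i j k l)\<^sup>2"
    using assms(7) by (metis of_int_eq_iff of_int_mult of_int_power)
  then have indep: "(?r \<bullet> ?r) * (?s \<bullet> ?s) \<noteq> (?r \<bullet> ?s)\<^sup>2"
    by (simp add: lat_inner)
  have q: "?t \<bullet> ?t = of_int q"
    unfolding lat_inner q_def lat_form_def by (simp add: algebra_simps)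
  have nz: "?r \<bullet> ?r \<noteq> 0" "?s \<bullet> ?s \<noteq> 0" "?t \<bullet> ?t \<noteq> 0"
    using roots zero_notin_G2_roots by (metis inner_eq_zero_iff)+
  have "real_of_int (N ?s ?t) * (?t \<bullet> ?t) = N ?r ?s * (?r \<bullet> ?r)"
    "real_of_int (N ?t ?r) * (?t \<bullet> ?t) = N ?r ?s * (?s \<bullet> ?s)"
    using N_cyclic[OF roots(1-3) sum roots(4-6) indep] nz by (simp_all add: field_simps)
  then show "N ?s ?t * q = N ?r ?s * lat_form i j i j" "N ?t ?r * q = N ?r ?s * lat_form k l k l"
    unfolding q unfolding lat_inner of_int_mult[symmetric] of_int_eq_iff by blast+
qed

lemma N_lat_anticommute:
  assumes "(i, j) \<in> root_coords" "(k, l) \<in> root_coords" "(i + k, j + l) \<in> root_coords"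
  shows "N (lat k l) (lat i j) = - N (lat i j) (lat k l)"
  using assms by (intro N_anticommute) (simp_all add: lat_in_G2_roots lat_add)

lemma N_lat_uminus:
  assumes "(i, j) \<in> root_coords" "(k, l) \<in> root_coords" "(i + k, j + l) \<in> root_coords"
  shows "N (lat (- i) (- j)) (lat (- k) (- l)) = - N (lat i j) (lat k l)"
  using assms N_uminus[of "lat i j" "lat k l"] by (simp add: lat_in_G2_roots lat_add lat_uminus)

text \<open>Rotation, swapping and negation generate, from \<open>x\<close>, the other eleven
  constants of a triple and its negative. The factor \<open>q\<close> stays on the left to avoid
  division; it cancels once the coordinates are numerals.\<close>

lemma N_lat_triple:
  assumes "(i, j) \<in> root_coords" "(k, l) \<in> root_coords" "(- i - k, - j - l) \<in> root_coords"
    and "(- i, - j) \<in> root_coords" "(- k, - l) \<in> root_coords" "(i + k, j + l) \<in> root_coords"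
    and "lat_form i j i j * lat_form k l k l \<noteq> (lat_form i j k l)\<^sup>2"
  defines "q \<equiv> lat_form (i + k) (j + l) (i + k) (j + l)"
    and "m \<equiv> i + k" and "n \<equiv> j + l" and "x \<equiv> N (lat i j) (lat k l)"
  shows "N (lat k l) (lat i j) = - x"
    "N (lat (- i) (- j)) (lat (- k) (- l)) = - x"
    "N (lat (- k) (- l)) (lat (- i) (- j)) = x"
    "N (lat k l) (lat (- m) (- n)) * q = x * lat_form i j i j"
    "N (lat (- m) (- n)) (lat k l) * q = - x * lat_form i j i j"
    "N (lat (- k) (- l)) (lat m n) * q = - x * lat_form i j i j"
    "N (lat m n) (lat (- k) (- l)) * q = x * lat_form i j i j"
    "N (lat (- m) (- n)) (lat i j) * q = x * lat_form k l k l"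
    "N (lat i j) (lat (- m) (- n)) * q = - x * lat_form k l k l"
    "N (lat m n) (lat (- i) (- j)) * q = - x * lat_form k l k l"
    "N (lat (- i) (- j)) (lat m n) * q = x * lat_form k l k l"
proof -
  have mn: "- i - k = - m" "- j - l = - n" and mem: "(- m, - n) \<in> root_coords" "(m, n) \<in> root_coords"
    using assms(3,6) by (simp_all add: m_def n_def)
  have cyc: "N (lat k l) (lat (- m) (- n)) * q = x * lat_form i j i j"
    "N (lat (- m) (- n)) (lat i j) * q = x * lat_form k l k l"
    using N_lat_cyclic[OF assms(1-7)] unfolding mn q_def x_def by blast+
  have anti: "N (lat k l) (lat i j) = - x"
    "N (lat (- k) (- l)) (lat (- i) (- j)) = - N (lat (- i) (- j)) (lat (- k) (- l))"
    "N (lat (- m) (- n)) (lat k l) = - N (lat k l) (lat (- m) (- n))"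
    "N (lat m n) (lat (- k) (- l)) = - N (lat (- k) (- l)) (lat m n)"
    "N (lat i j) (lat (- m) (- n)) = - N (lat (- m) (- n)) (lat i j)"
    "N (lat (- i) (- j)) (lat m n) = - N (lat m n) (lat (- i) (- j))"
    unfolding x_def using assms(1-6) mem by (intro N_lat_anticommute; simp add: m_def n_def)+
  have neg: "N (lat (- i) (- j)) (lat (- k) (- l)) = - x"
    "N (lat (- k) (- l)) (lat m n) = - N (lat k l) (lat (- m) (- n))"
    "N (lat m n) (lat (- i) (- j)) = - N (lat (- m) (- n)) (lat i j)"
    using N_lat_uminus[of i j k l] N_lat_uminus[of k l "- m" "- n"] N_lat_uminus[of "- m" "- n" i j]
      assms(1-6) mem by (simp_all add: m_def n_def x_def add.commute)
  show "N (lat k l) (lat i j) = - x"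
    "N (lat (- i) (- j)) (lat (- k) (- l)) = - x"
    "N (lat (- k) (- l)) (lat (- i) (- j)) = x"
    "N (lat k l) (lat (- m) (- n)) * q = x * lat_form i j i j"
    "N (lat (- m) (- n)) (lat k l) * q = - x * lat_form i j i j"
    "N (lat (- k) (- l)) (lat m n) * q = - x * lat_form i j i j"
    "N (lat m n) (lat (- k) (- l)) * q = x * lat_form i j i j"
    "N (lat (- m) (- n)) (lat i j) * q = x * lat_form k l k l"
    "N (lat i j) (lat (- m) (- n)) * q = - x * lat_form k l k l"
    "N (lat m n) (lat (- i) (- j)) * q = - x * lat_form k l k l"
    "N (lat (- i) (- j)) (lat m n) * q = x * lat_form k l k l"
    using cyc by (simp_all add: anti neg)
qed

text \<open>The root string fixes the constant up to sign; as \<open>p + 1\<close> is positive, the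
  negative alternative is excluded.\<close>

lemma N_lat_positive:
  assumes "(i, j) \<in> root_coords" "(k, l) \<in> root_coords" "(i + k, j + l) \<in> root_coords"
    and "N (lat i j) (lat k l) > 0"
    and "(k - p * i, l - p * j) \<in> root_coords"
    and "\<And>q. (k - q * i, l - q * j) \<in> root_coords \<Longrightarrow> q \<le> p" and "p \<ge> 0"
  shows "N (lat i j) (lat k l) = p + 1"
proof -
  have "N (lat i j) (lat k l) = p + 1 \<or> N (lat i j) (lat k l) = - (p + 1)"
    using assms(1-3) N_string[of "lat i j" "lat k l"] string_depth_lat_eqI[OF assms(5,6)]
    by (simp add: lat_in_G2_roots lat_add)
  with assms(4,7) show ?thesis by linarith
qed

end

section \<open>Evaluation of the table\<close>

theorem theorem2:
  fixes scale :: "complex \<Rightarrow> 'g::ab_group_add \<Rightarrow> 'g"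
    and bracket :: "'g \<Rightarrow> 'g \<Rightarrow> 'g"
    and h e :: "real^3 \<Rightarrow> 'g"
    and N :: "real^3 \<Rightarrow> real^3 \<Rightarrow> int"
  assumes "G2_chevalley_basis scale bracket h e N"
    and "N ra rb > 0"
    and "N ra (ra + rb) > 0"
    and "N ra (2 *\<^sub>R ra + rb) > 0"
    and "N rb (3 *\<^sub>R ra + rb) > 0"
  shows "(\<forall>(r, s, n) \<in> G2_entries. N r s = n) \<and>
    (\<forall>r\<in>G2_roots. \<forall>s\<in>G2_roots.
      r + s \<noteq> 0 \<and> (\<nexists>n. (r, s, n) \<in> G2_entries) \<longrightarrow> N r s = 0)"
proof -
  interpret G2_chevalley_basis scale bracket h e N by fact
  have extraspecial: "N (lat 1 0) (lat 0 1) = 1" "N (lat 1 0) (lat 1 1) = 2"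
    "N (lat 1 0) (lat 2 1) = 3" "N (lat 0 1) (lat 3 1) = 1"
  proof -
    \<comment> \<open>In each sum the first summand is the depth \<open>p\<close> of the root
      string, here and below 0, 1, 2 and 0.\<close>
    have "N (lat 1 0) (lat 0 1) = 0 + 1"
      using assms(2) by (intro N_lat_positive) (auto simp: root_coords_def ra_lat rb_lat lat_simps)
    moreover have "N (lat 1 0) (lat 1 1) = 1 + 1"
      using assms(3) by (intro N_lat_positive) (auto simp: root_coords_def ra_lat rb_lat lat_simps)
    moreover have "N (lat 1 0) (lat 2 1) = 2 + 1"
      using assms(4) by (intro N_lat_positive) (auto simp: root_coords_def ra_lat rb_lat lat_simps)
    moreover have "N (lat 0 1) (lat 3 1) = 0 + 1"
      using assms(5) by (intro N_lat_positive) (auto simp: root_coords_def ra_lat rb_lat lat_simps)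
    ultimately show "N (lat 1 0) (lat 0 1) = 1" "N (lat 1 0) (lat 1 1) = 2"
      "N (lat 1 0) (lat 2 1) = 3" "N (lat 0 1) (lat 3 1) = 1" by simp_all
  qed
  have "N (lat 2 1) (lat 1 0) = -3"
    using N_lat_anticommute[of 1 0 2 1] extraspecial by (simp add: root_coords_def)
  \<comment> \<open>Here \<open>s + t\<close> is \<open>2a + 2b\<close>, not a root, and the
    identity reads \<open>(-3) * 1 + 1 * N (2a + b) (a + b) = 0\<close>.\<close>
  then have fifth: "N (lat 2 1) (lat 1 1) = 3"
    using N_jacobi[of "lat 1 0" "lat 0 1" "lat 2 1"] extraspecial
    by (simp add: lat_in_G2_roots lat_simps root_coords_def)
  \<comment> \<open>Five triples with twelve constants each account for all 60 entries of the
    table.\<close>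
  note triples =
    N_lat_triple[of 1 0 0 1, simplified root_coords_def lat_form_def extraspecial, simplified]
    N_lat_triple[of 1 0 1 1, simplified root_coords_def lat_form_def extraspecial, simplified]
    N_lat_triple[of 1 0 2 1, simplified root_coords_def lat_form_def extraspecial, simplified]
    N_lat_triple[of 0 1 3 1, simplified root_coords_def lat_form_def extraspecial, simplified]
    N_lat_triple[of 2 1 1 1, simplified root_coords_def lat_form_def fifth, simplified]
  have "\<forall>(r, s, n) \<in> G2_entries. N r s = n"
    unfolding G2_entries_def G2_table_def Let_def ra_lat rb_lat lat_simps
    by (auto simp: lat_simps extraspecial fifth triples)
  moreover have "N r s = 0" if "r \<in> G2_roots" "s \<in> G2_roots" "r + s \<noteq> 0"
    "\<nexists>n. (r, s, n) \<in> G2_entries" for r s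
    using that G2_entries_complete N_zero by blast
  ultimately show ?thesis by blast
qed

end
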